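(* If $n \geq 3$ and $A \in \mathcal{M}_n^{+}$ has factor width $2$ and no entries equal to $0$, then $\mathrm{fran}_2(A) = \frac{n(n-1)}{2}$.
   Context: Let $\mathbb{F} \in \{\mathbb{R},\mathbb{C}\}$ (the result holds for either field). $\mathcal{M}_n^{+}$ denotes the set of $n \times n$ positive semidefinite (real symmetric if $\mathbb{F}=\mathbb{R}$, Hermitian if $\mathbb{F}=\mathbb{C}$) matrices over $\mathbb{F}$. The factor width of $A \in \mathcal{M}_n^{+}$ is the smallest positive integer $k$ such that $A = \sum_{j=1}^r \mathbf{v}_j\mathbf{v}_j^*$ for some $r$ and some $\mathbf{v}_1,\ldots,\mathbf{v}_r \in \mathbb{F}^n$, each with at most $k$ non-zero entries. If $A$ has factor width at most $k$, $\mathrm{fran}_k(A)$ (the factor-width-$k$ rank) is the least integer $r$ for which such a decomposition with vectors having at most $k$ non-zero entries exists. *)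

theory Defs
  imports "Jordan_Normal_Form.Schur_Decomposition" "HOL-Library.Extended_Nat"
begin

text \<open>
  All notions are generic in the scalar type and are meant for \<^typ>\<open>real\<close> (where \<^const>\<open>conjugate\<close> is
  the identity) and \<^typ>\<open>complex\<close> (where it is complex conjugation).  On \<^typ>\<open>complex\<close>, \<open>0 \<le> z\<close>
  means that \<open>z\<close> is real and nonnegative.
\<close>

definition psd_mats :: "nat \<Rightarrow> 'a :: conjugatable_ordered_field mat set" where
  "psd_mats n = {A \<in> carrier_mat n n. mat_adjoint A = A \<and>
     (\<forall>v \<in> carrier_vec n. 0 \<le> (A *\<^sub>v v) \<bullet>c v)}"

text \<open>The matrix \<open>v v\<^sup>*\<close>.\<close>

definition outer :: "'a :: conjugatable_field vec \<Rightarrow> 'a mat" where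
  "outer v = mat (dim_vec v) (dim_vec v) (\<lambda>(i, j). v $ i * conjugate (v $ j))"

definition nnz :: "'a :: zero vec \<Rightarrow> nat" where
  "nnz v = card {i. i < dim_vec v \<and> v $ i \<noteq> 0}"

definition fw_decomp :: "nat \<Rightarrow> 'a :: conjugatable_field mat \<Rightarrow> 'a vec list \<Rightarrow> bool" where
  "fw_decomp k A vs \<longleftrightarrow>
     (\<forall>v \<in> set vs. v \<in> carrier_vec (dim_row A) \<and> nnz v \<le> k) \<and>
     A = foldr (+) (map outer vs) (0\<^sub>m (dim_row A) (dim_row A))"

text \<open>
  Both minima are taken in \<^typ>\<open>enat\<close>: an infimum of a nonempty set is attained, and the value is
  \<open>\<infinity>\<close> exactly when there is no decomposition of the required kind.
\<close>

definition factor_width :: "'a :: conjugatable_field mat \<Rightarrow> enat" where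
  "factor_width A = Inf {enat k |k. 0 < k \<and> (\<exists>vs. fw_decomp k A vs)}"

definition fran :: "nat \<Rightarrow> 'a :: conjugatable_field mat \<Rightarrow> enat" where
  "fran k A = Inf {enat r |r. \<exists>vs. fw_decomp k A vs \<and> length vs = r}"

lemma Inf_enat_eq_enat_iff:
  "Inf {enat k |k. P k} = enat m \<longleftrightarrow> P m \<and> (\<forall>k. P k \<longrightarrow> m \<le> k)"
proof
  assume eq: "Inf {enat k |k. P k} = enat m"
  then have ne: "{enat k |k. P k} \<noteq> {}"
    unfolding Inf_enat_def by (metis enat.distinct(1))
  then obtain x where "x \<in> {enat k |k. P k}"
    by blast
  then have "Inf {enat k |k. P k} \<in> {enat k |k. P k}"
    unfolding Inf_enat_def using ne by (simp only: if_False) (rule LeastI)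
  then have "P m"
    by (auto simp: eq)
  moreover have "m \<le> k" if "P k" for k
    using Inf_lower[of "enat k" "{enat k |k. P k}"] that by (auto simp: eq)
  ultimately show "P m \<and> (\<forall>k. P k \<longrightarrow> m \<le> k)"
    by blast
next
  assume "P m \<and> (\<forall>k. P k \<longrightarrow> m \<le> k)"
  then show "Inf {enat k |k. P k} = enat m"
    by (intro antisym Inf_lower Inf_greatest) auto
qed

lemma factor_width_eq_iff:
  "factor_width A = enat m \<longleftrightarrow>
     (0 < m \<and> (\<exists>vs. fw_decomp m A vs)) \<and>
     (\<forall>k. 0 < k \<and> (\<exists>vs. fw_decomp k A vs) \<longrightarrow> m \<le> k)"
  unfolding factor_width_def by (rule Inf_enat_eq_enat_iff)

lemma fran_eq_iff:
  "fran k A = enat m \<longleftrightarrow>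
     (\<exists>vs. fw_decomp k A vs \<and> length vs = m) \<and>
     (\<forall>r. (\<exists>vs. fw_decomp k A vs \<and> length vs = r) \<longrightarrow> m \<le> r)"
  unfolding fran_def by (rule Inf_enat_eq_enat_iff)

end

theory Submission
  imports Defs "HOL-Analysis.L2_Norm"
begin

text \<open>
  Let \<open>A\<close> have no zero entry and factor width 2.

  Lower bound: an off-diagonal entry \<open>(i, j)\<close> can only be produced by a vector whose support is
  exactly \<open>{i, j}\<close>, so every 2-subset of the index set is the support of some vector of a
  decomposition (\<open>two_subset_is_support\<close>).

  Upper bound: one vector per 2-subset has to suffice.  A vector supported on \<open>{i, j}\<close> contributes
  positive amounts \<open>x i j\<close> and \<open>x j i\<close> to the diagonal entries at \<open>i\<close> and \<open>j\<close>; it creates the right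
  off-diagonal entries exactly when its phases are right and \<open>x i j * x j i = \<bar>A i j\<bar>\<^sup>2\<close>.  So the
  task is to find positive weights with these products whose row sums are the diagonal of \<open>A\<close>
  (\<open>fw_decomp_of_weights\<close>).  Grouping the vectors of any decomposition by their supports gives,
  by Cauchy-Schwarz, weights with the right products whose row sums are at most the diagonal
  (\<open>weights_below_diagonal\<close>).

  It remains to use up the slack of one row without touching the others, and this is where \<open>n \<ge> 3\<close>
  enters.  Pick a triangle \<open>i, j, k\<close> and raise \<open>x i j\<close>.  The fixed product lowers \<open>x j i\<close>; row \<open>j\<close>
  is repaired by raising \<open>x j k\<close>, which lowers \<open>x k j\<close>; row \<open>k\<close> is repaired by raising \<open>x k i\<close>,
  which lowers \<open>x i k\<close>.  Only row \<open>i\<close> changes in total.  Its sum depends continuously on the initial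
  increase and is unbounded, because \<open>x i k\<close> stays positive, so the intermediate value theorem
  makes it equal to any prescribed larger value (\<open>fill_cycle\<close>, \<open>fill_row\<close>).
\<close>

section \<open>Filling the row sums of a weight function\<close>

text \<open>
  The scalar form of the move around a triangle: \<open>(p, p')\<close>, \<open>(q, q')\<close> and \<open>(r, r')\<close> are the pairs of
  weights on the edges \<open>ij\<close>, \<open>jk\<close> and \<open>ki\<close>.  The product on each edge is kept, the sum at \<open>i\<close> grows
  by \<open>s\<close>, and the sums at \<open>j\<close> and \<open>k\<close> stay.
\<close>

lemma fill_cycle:
  fixes p p' q q' r r' s :: real
  assumes pos: "0 < p" "0 < p'" "0 < q" "0 < q'" "0 < r" "0 < r'" and s: "0 \<le> s"
  obtains P P' Q Q' R R' where
    "0 < P" "0 < P'" "0 < Q" "0 < Q'" "0 < R" "0 < R'"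
    "P * P' = p * p'" "Q * Q' = q * q'" "R * R' = r * r'"
    "P + R' = p + r' + s" "Q + P' = q + p'" "R + Q' = r + q'"
proof -
  define P' where "P' a = p * p' / (p + a)" for a
  define Q where "Q a = q + p' - P' a" for a
  define Q' where "Q' a = q * q' / Q a" for a
  define R where "R a = r + q' - Q' a" for a
  define R' where "R' a = r * r' / R a" for a
  have P': "0 < P' a" "P' a \<le> p'" if "0 \<le> a" for a
    using pos that by (auto simp: P'_def divide_simps mult.commute mult_left_mono)
  have Q: "q \<le> Q a" if "0 \<le> a" for a
    using P'[OF that] by (simp add: Q_def)
  then have Q_pos: "0 < Q a" if "0 \<le> a" for a
    using pos that by (meson less_le_trans)
  have Q': "0 < Q' a" "Q' a \<le> q'" if "0 \<le> a" for a
    using Q[OF that] Q_pos[OF that] pos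
    by (auto simp: Q'_def divide_simps mult.commute mult_left_mono)
  have R_pos: "0 < R a" if "0 \<le> a" for a
    using Q'[OF that] pos by (simp add: R_def)
  have R'_pos: "0 < R' a" if "0 \<le> a" for a
    using R_pos[OF that] pos by (simp add: R'_def)
  have cont: "continuous_on {0..s + r'} (\<lambda>a. a + R' a)"
  proof -
    have "continuous_on {0..s + r'} P'"
      unfolding P'_def using pos by (intro continuous_intros) auto
    then have "continuous_on {0..s + r'} Q"
      unfolding Q_def by (intro continuous_intros)
    then have "continuous_on {0..s + r'} Q'"
      unfolding Q'_def using Q_pos by (intro continuous_intros) (auto simp: less_imp_neq[symmetric])
    then have "continuous_on {0..s + r'} R"
      unfolding R_def by (intro continuous_intros)
    then show ?thesis
      unfolding R'_def using R_pos by (intro continuous_intros) (auto simp: less_imp_neq[symmetric])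
  qed
  have "R' 0 = r'"
    using pos by (simp add: R'_def R_def Q'_def Q_def P'_def)
  \<comment> \<open>Since \<open>R'\<close> is positive, the sum \<open>a + R' a\<close> has passed its target at \<open>a = s + r'\<close>.\<close>
  then have "\<exists>a\<ge>0. a \<le> s + r' \<and> a + R' a = s + r'"
    using pos s R'_pos[of "s + r'"] by (intro IVT' cont) auto
  then obtain a where a: "0 \<le> a" "a + R' a = s + r'"
    by blast
  show thesis
    by (rule that[of "p + a" "P' a" "Q a" "Q' a" "R a" "R' a"])
      (use a pos P'[OF a(1)] Q_pos[OF a(1)] Q'[OF a(1)] R_pos[OF a(1)] R'_pos[OF a(1)]
        in \<open>auto simp: P'_def Q'_def R'_def Q_def R_def\<close>)
qed

lemma fill_row:
  fixes x :: "'b \<Rightarrow> 'b \<Rightarrow> real"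
  assumes fin: "finite V" and V: "i \<in> V" "j \<in> V" "k \<in> V"
    and ne: "i \<noteq> j" "j \<noteq> k" "k \<noteq> i"
    and pos: "\<And>u v. u \<in> V \<Longrightarrow> v \<in> V \<Longrightarrow> u \<noteq> v \<Longrightarrow> 0 < x u v"
    and le: "sum (x i) (V - {i}) \<le> d"
  obtains y where
    "\<And>u v. u \<in> V \<Longrightarrow> v \<in> V \<Longrightarrow> u \<noteq> v \<Longrightarrow> 0 < y u v"
    "\<And>u v. u \<in> V \<Longrightarrow> v \<in> V \<Longrightarrow> u \<noteq> v \<Longrightarrow> y u v * y v u = x u v * x v u"
    "sum (y i) (V - {i}) = d"
    "\<And>u. u \<in> V \<Longrightarrow> u \<noteq> i \<Longrightarrow> sum (y u) (V - {u}) = sum (x u) (V - {u})"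
proof -
  obtain P P' Q Q' R R' where
    new_pos: "0 < P" "0 < P'" "0 < Q" "0 < Q'" "0 < R" "0 < R'" and
    prods: "P * P' = x i j * x j i" "Q * Q' = x j k * x k j" "R * R' = x k i * x i k" and
    sums: "P + R' = x i j + x i k + (d - sum (x i) (V - {i}))"
      "Q + P' = x j k + x j i" "R + Q' = x k i + x k j"
    by (rule fill_cycle[of "x i j" "x j i" "x j k" "x k j" "x k i" "x i k"
        "d - sum (x i) (V - {i})"]) (use pos V ne le in auto)
  define y where "y = x(i := (x i)(j := P, k := R'), j := (x j)(k := Q, i := P'),
    k := (x k)(i := R, j := Q'))"
  have split: "sum f (V - {a}) = f b + f c + sum f (V - {i, j, k})"
    if "{a, b, c} = {i, j, k}" for f :: "'b \<Rightarrow> real" and a b c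
  proof -
    have "card {a, b, c} = 3"
      using that ne by simp
    then have "a \<noteq> b" "a \<noteq> c" "b \<noteq> c"
      by (auto simp: card_insert_if split: if_splits)
    moreover have "b \<in> {i, j, k}" "c \<in> {i, j, k}"
      unfolding that[symmetric] by simp_all
    moreover from this have "b \<in> V" "c \<in> V"
      using V by auto
    ultimately have "V - {a} = insert b (insert c (V - {i, j, k}))"
      using that by blast
    then show ?thesis
      using fin \<open>b \<noteq> c\<close> \<open>b \<in> {i, j, k}\<close> \<open>c \<in> {i, j, k}\<close> by simp
  qed
  have rest: "sum (y u) (V - {i, j, k}) = sum (x u) (V - {i, j, k})" for u
    by (rule sum.cong) (auto simp: y_def)
  have row_i: "sum (f i) (V - {i}) = f i j + f i k + sum (f i) (V - {i, j, k})"
    and row_j: "sum (f j) (V - {j}) = f j k + f j i + sum (f j) (V - {i, j, k})"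
    and row_k: "sum (f k) (V - {k}) = f k i + f k j + sum (f k) (V - {i, j, k})"
    for f :: "'b \<Rightarrow> 'b \<Rightarrow> real"
    by (rule split; blast)+
  show thesis
  proof (rule that[of y])
    show "0 < y u v" if "u \<in> V" "v \<in> V" "u \<noteq> v" for u v
      using that pos new_pos by (auto simp: y_def)
    show "y u v * y v u = x u v * x v u" if "u \<in> V" "v \<in> V" "u \<noteq> v" for u v
      using that prods ne by (auto simp: y_def mult.commute)
    have "y i j = P" "y i k = R'"
      using ne by (auto simp: y_def)
    then show "sum (y i) (V - {i}) = d"
      using sums(1) row_i[of y] row_i[of x] rest[of i] by linarith
    have "y j k = Q" "y j i = P'" "y k i = R" "y k j = Q'"
      using ne by (auto simp: y_def)
    then have "sum (y j) (V - {j}) = sum (x j) (V - {j})"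
      "sum (y k) (V - {k}) = sum (x k) (V - {k})"
      using sums row_j[of y] row_j[of x] rest[of j] row_k[of y] row_k[of x] rest[of k] by linarith+
    moreover have "y u = x u" if "u \<noteq> i" "u \<noteq> j" "u \<noteq> k" for u
      using that by (simp add: y_def)
    ultimately show "sum (y u) (V - {u}) = sum (x u) (V - {u})" if "u \<in> V" "u \<noteq> i" for u
      using that by metis
  qed
qed

text \<open>
  Rows can be filled one after the other, because filling a row leaves the sums of the others alone.
\<close>

lemma fill_all_rows:
  fixes x :: "'b \<Rightarrow> 'b \<Rightarrow> real"
  assumes fin: "finite V" and card: "3 \<le> card V"
    and pos: "\<And>u v. u \<in> V \<Longrightarrow> v \<in> V \<Longrightarrow> u \<noteq> v \<Longrightarrow> 0 < x u v"
    and le: "\<And>u. u \<in> V \<Longrightarrow> sum (x u) (V - {u}) \<le> d u"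
  obtains y where
    "\<And>u v. u \<in> V \<Longrightarrow> v \<in> V \<Longrightarrow> u \<noteq> v \<Longrightarrow> 0 < y u v"
    "\<And>u v. u \<in> V \<Longrightarrow> v \<in> V \<Longrightarrow> u \<noteq> v \<Longrightarrow> y u v * y v u = x u v * x v u"
    "\<And>u. u \<in> V \<Longrightarrow> sum (y u) (V - {u}) = d u"
proof -
  have "\<exists>y. (\<forall>u\<in>V. \<forall>v\<in>V. u \<noteq> v \<longrightarrow> 0 < y u v \<and> y u v * y v u = x u v * x v u) \<and>
      (\<forall>u\<in>V. sum (y u) (V - {u}) \<le> d u) \<and> (\<forall>u\<in>W. sum (y u) (V - {u}) = d u)"
    if "W \<subseteq> V" for W
    using finite_subset[OF that fin] that
  proof (induction W rule: finite_induct)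
    case empty
    show ?case
      using pos le by (intro exI[of _ x]) auto
  next
    case (insert i W)
    then obtain y where y:
      "\<forall>u\<in>V. \<forall>v\<in>V. u \<noteq> v \<longrightarrow> 0 < y u v \<and> y u v * y v u = x u v * x v u"
      "\<forall>u\<in>V. sum (y u) (V - {u}) \<le> d u" "\<forall>u\<in>W. sum (y u) (V - {u}) = d u"
      by blast
    have i: "i \<in> V"
      using insert.prems by simp
    have "2 \<le> card (V - {i})"
      using card fin i by simp
    then obtain T where "T \<subseteq> V - {i}" "card T = 2"
      by (meson obtain_subset_with_card_n)
    then obtain j k where jk: "j \<in> V" "k \<in> V" "i \<noteq> j" "j \<noteq> k" "k \<noteq> i"
      by (auto simp: card_2_iff)
    obtain z where z:
      "\<And>u v. u \<in> V \<Longrightarrow> v \<in> V \<Longrightarrow> u \<noteq> v \<Longrightarrow> 0 < z u v"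
      "\<And>u v. u \<in> V \<Longrightarrow> v \<in> V \<Longrightarrow> u \<noteq> v \<Longrightarrow> z u v * z v u = y u v * y v u"
      "sum (z i) (V - {i}) = d i"
      "\<And>u. u \<in> V \<Longrightarrow> u \<noteq> i \<Longrightarrow> sum (z u) (V - {u}) = sum (y u) (V - {u})"
      by (rule fill_row[OF fin i jk, of y "d i"]) (use y i in auto)
    have "sum (z u) (V - {u}) \<le> d u" if "u \<in> V" for u
      using z(3,4) y(2) that by (cases "u = i") auto
    moreover have "sum (z u) (V - {u}) = d u" if "u \<in> insert i W" for u
      using z(3,4) y(3) that insert.prems by (cases "u = i") auto
    ultimately show ?case
      using z(1,2) y(1) by (intro exI[of _ z]) simp
  qed
  from this[OF subset_refl] show thesis
    using that by blast
qed

section \<open>Decompositions entrywise\<close>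

text \<open>What the argument uses of the conjugation on \<open>\<real>\<close> and \<open>\<complex>\<close>.\<close>

class normed_conjugatable_field = real_normed_field + conjugatable_field +
  assumes mult_conjugate_scaleR: "x * conjugate x = (norm x)\<^sup>2 *\<^sub>R 1"

instance real :: normed_conjugatable_field
  by standard (simp add: power2_eq_square abs_mult_self_eq)

instance complex :: normed_conjugatable_field
proof
  fix x :: complex
  have "x * conjugate x = of_real ((norm x)\<^sup>2)"
    by (simp only: conjugate_complex_def complex_norm_square)
  then show "x * conjugate x = (norm x)\<^sup>2 *\<^sub>R 1"
    by (simp only: of_real_def)
qed

lemma mult_conjugate_self:
  "x * conjugate x = of_real ((norm (x :: 'a :: normed_conjugatable_field))\<^sup>2)"
  by (simp add: mult_conjugate_scaleR of_real_def)

lemma norm_conjugate: "norm (conjugate x) = norm (x :: 'a :: normed_conjugatable_field)"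
proof -
  have "of_real ((norm (conjugate x))\<^sup>2) = (of_real ((norm x)\<^sup>2) :: 'a)"
    using mult_conjugate_self[of x] mult_conjugate_self[of "conjugate x"]
    by (simp add: mult.commute)
  then have "(norm (conjugate x))\<^sup>2 = (norm x)\<^sup>2"
    using of_real_eq_iff by blast
  then show ?thesis
    by simp
qed

definition support :: "'a :: zero vec \<Rightarrow> nat set" where
  "support v = {i. i < dim_vec v \<and> v $ i \<noteq> 0}"

lemma finite_support [simp]: "finite (support v)"
  by (simp add: support_def)

lemma nnz_eq_card_support: "nnz v = card (support v)"
  by (simp add: nnz_def support_def)

lemma sum_outer_eq:
  assumes "\<forall>v \<in> set vs. v \<in> carrier_vec n"
  shows "foldr (+) (map outer vs) (0\<^sub>m n n) =
    mat n n (\<lambda>(i, j). \<Sum>v\<leftarrow>vs. v $ i * conjugate (v $ j))"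
  using assms
proof (induction vs)
  case Nil
  show ?case by (auto intro!: eq_matI)
next
  case (Cons v vs)
  then show ?case by (auto intro!: eq_matI simp: outer_def)
qed

lemma fw_decomp_iff:
  assumes "A \<in> carrier_mat n n"
  shows "fw_decomp k A vs \<longleftrightarrow>
    (\<forall>v \<in> set vs. v \<in> carrier_vec n \<and> card (support v) \<le> k) \<and>
    (\<forall>i < n. \<forall>j < n. A $$ (i, j) = (\<Sum>v\<leftarrow>vs. v $ i * conjugate (v $ j)))"
proof (cases "\<forall>v \<in> set vs. v \<in> carrier_vec n")
  case True
  have "A = mat n n f \<longleftrightarrow> (\<forall>i < n. \<forall>j < n. A $$ (i, j) = f (i, j))" for f
    using assms by (auto intro!: eq_matI)
  then show ?thesis
    using assms True by (auto simp: fw_decomp_def nnz_eq_card_support sum_outer_eq[OF True])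
next
  case False
  then show ?thesis
    using assms by (auto simp: fw_decomp_def)
qed

section \<open>The lower bound\<close>

lemma support_eq_pair:
  assumes "v \<in> carrier_vec n" "card (support v) \<le> 2" "i < n" "j < n" "i \<noteq> j"
    and "v $ i \<noteq> 0" "v $ j \<noteq> 0"
  shows "support v = {i, j}"
proof -
  have "{i, j} \<subseteq> support v"
    using assms by (auto simp: support_def)
  moreover have "card (support v) \<le> card {i, j}"
    using assms by simp
  ultimately show ?thesis
    by (metis card_seteq finite_support)
qed

lemma two_subset_is_support:
  assumes A: "A \<in> carrier_mat n n" and vs: "fw_decomp 2 A vs"
    and ij: "i < n" "j < n" "i \<noteq> j" and nz: "A $$ (i, j) \<noteq> 0"
  shows "{i, j} \<in> support ` set vs"
proof -
  have "(\<Sum>v\<leftarrow>vs. v $ i * conjugate (v $ j)) \<noteq> 0"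
    using A vs ij nz by (simp add: fw_decomp_iff)
  then obtain v where v: "v \<in> set vs" "v $ i * conjugate (v $ j) \<noteq> 0"
    by (metis (mono_tags, lifting) map_cong sum_list_0)
  then have "support v = {i, j}"
    using A vs ij by (intro support_eq_pair[of v n]) (auto simp: fw_decomp_iff)
  then show ?thesis
    using v by force
qed

lemma choose_two_le_length_decomp:
  assumes A: "A \<in> carrier_mat n n" and vs: "fw_decomp 2 A vs"
    and nz: "\<forall>i < n. \<forall>j < n. A $$ (i, j) \<noteq> 0"
  shows "n choose 2 \<le> length vs"
proof -
  have "{B. B \<subseteq> {..<n} \<and> card B = 2} \<subseteq> support ` set vs"
    using two_subset_is_support[OF A vs] nz by (auto simp: card_2_iff)
  then have "card {B. B \<subseteq> {..<n} \<and> card B = 2} \<le> card (support ` set vs)"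
    by (intro card_mono) auto
  also have "\<dots> \<le> card (set vs)"
    by (simp add: card_image_le)
  also have "\<dots> \<le> length vs"
    by (rule card_length)
  finally show ?thesis
    by (simp add: n_subsets)
qed

section \<open>The upper bound\<close>

lemma hermitian_of_decomp:
  fixes A :: "'a :: normed_conjugatable_field mat"
  assumes "A \<in> carrier_mat n n" "fw_decomp k A vs" "i < n" "j < n"
  shows "A $$ (j, i) = conjugate (A $$ (i, j))"
proof -
  have "conjugate (\<Sum>v\<leftarrow>vs. v $ i * conjugate (v $ j)) = (\<Sum>v\<leftarrow>vs. v $ j * conjugate (v $ i))"
    by (induction vs) (auto simp: conjugate_dist_add conjugate_dist_mul mult.commute)
  then show ?thesis
    using assms by (simp add: fw_decomp_iff)
qed

text \<open>
  The weight \<open>y i j\<close> collects what the vectors supported on \<open>{i, j}\<close> contribute to the diagonal entry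
  at \<open>i\<close>.  Vectors supported on a single index only add to the slack.
\<close>

lemma excess_weights_below_diagonal:
  fixes A :: "'a :: normed_conjugatable_field mat"
  assumes A: "A \<in> carrier_mat n n" and vs: "fw_decomp 2 A vs"
  obtains y :: "nat \<Rightarrow> nat \<Rightarrow> real" and d :: "nat \<Rightarrow> real" where
    "\<And>i j. 0 \<le> y i j"
    "\<And>i j. i < n \<Longrightarrow> j < n \<Longrightarrow> i \<noteq> j \<Longrightarrow> (norm (A $$ (i, j)))\<^sup>2 \<le> y i j * y j i"
    "\<And>i. i < n \<Longrightarrow> A $$ (i, i) = of_real (d i)"
    "\<And>i. i < n \<Longrightarrow> sum (y i) ({..<n} - {i}) \<le> d i"
proof -
  define L where "L = {0..<length vs}"
  define y where "y i j = (\<Sum>l\<in>L. if vs ! l $ j = 0 then 0 else (norm (vs ! l $ i))\<^sup>2)" for i j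
  define d where "d i = (\<Sum>l\<in>L. (norm (vs ! l $ i))\<^sup>2)" for i
  have entry: "A $$ (i, j) = (\<Sum>l\<in>L. vs ! l $ i * conjugate (vs ! l $ j))"
    if "i < n" "j < n" for i j
    using that A vs by (simp add: fw_decomp_iff sum_list_sum_nth L_def)
  have vec: "vs ! l \<in> carrier_vec n" "card (support (vs ! l)) \<le> 2" if "l \<in> L" for l
    using that A vs by (auto simp: fw_decomp_iff L_def)
  show thesis
  proof (rule that[of y d])
    show "0 \<le> y i j" for i j
      by (auto simp: y_def intro!: sum_nonneg)
  next
    fix i j assume ij: "i < n" "j < n" "i \<noteq> j"
    define f where "f a b l = (if vs ! l $ b = 0 then 0 else norm (vs ! l $ a))" for a b l
    have y_eq: "y a b = (L2_set (f a b) L)\<^sup>2" for a b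
      by (auto simp: y_def L2_set_def f_def sum_nonneg intro!: sum.cong)
    have "norm (A $$ (i, j)) \<le> (\<Sum>l\<in>L. norm (vs ! l $ i * conjugate (vs ! l $ j)))"
      unfolding entry[OF ij(1,2)] by (rule norm_sum)
    also have "\<dots> = (\<Sum>l\<in>L. \<bar>f i j l\<bar> * \<bar>f j i l\<bar>)"
      by (rule sum.cong) (auto simp: f_def norm_mult norm_conjugate)
    also have "\<dots> \<le> L2_set (f i j) L * L2_set (f j i) L"
      by (rule L2_set_mult_ineq)
    finally show "(norm (A $$ (i, j)))\<^sup>2 \<le> y i j * y j i"
      by (simp add: y_eq power_mono flip: power_mult_distrib)
  next
    fix i assume i: "i < n"
    show "A $$ (i, i) = of_real (d i)"
      by (simp add: entry[OF i i] d_def mult_conjugate_self)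
    have "sum (y i) ({..<n} - {i}) =
      (\<Sum>l\<in>L. \<Sum>j\<in>{..<n} - {i}. if vs ! l $ j = 0 then 0 else (norm (vs ! l $ i))\<^sup>2)"
      unfolding y_def by (rule sum.swap)
    also have "\<dots> \<le> d i"
      unfolding d_def
    proof (rule sum_mono)
      fix l assume l: "l \<in> L"
      let ?v = "vs ! l"
      let ?J = "{j \<in> {..<n} - {i}. ?v $ j \<noteq> 0}"
      have "(\<Sum>j\<in>{..<n} - {i}. if ?v $ j = 0 then 0 else (norm (?v $ i))\<^sup>2) =
        (\<Sum>j\<in>?J. (norm (?v $ i))\<^sup>2)"
        by (rule sum.mono_neutral_cong_right) auto
      also have "\<dots> = real (card ?J) * (norm (?v $ i))\<^sup>2"
        by simp
      also have "\<dots> \<le> (norm (?v $ i))\<^sup>2"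
      proof (cases "?v $ i = 0")
        case False
        then have "support ?v = insert i ?J"
          using vec[OF l] i by (auto simp: support_def)
        then have "card ?J \<le> 1"
          using vec(2)[OF l] by simp
        then show ?thesis
          by (simp add: mult_left_le_one_le)
      qed simp
      finally show "(\<Sum>j\<in>{..<n} - {i}. if ?v $ j = 0 then 0 else (norm (?v $ i))\<^sup>2) \<le>
        (norm (?v $ i))\<^sup>2" .
    qed
    finally show "sum (y i) ({..<n} - {i}) \<le> d i" .
  qed
qed

text \<open>
  Excess in a product is removed by lowering one of the two weights of the pair, which only lowers
  row sums.
\<close>

lemma weights_below_diagonal:
  fixes A :: "'a :: normed_conjugatable_field mat"
  assumes A: "A \<in> carrier_mat n n" and vs: "fw_decomp 2 A vs"
    and nz: "\<forall>i < n. \<forall>j < n. A $$ (i, j) \<noteq> 0"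
  obtains x :: "nat \<Rightarrow> nat \<Rightarrow> real" and d :: "nat \<Rightarrow> real" where
    "\<And>i j. i < n \<Longrightarrow> j < n \<Longrightarrow> i \<noteq> j \<Longrightarrow> 0 < x i j"
    "\<And>i j. i < n \<Longrightarrow> j < n \<Longrightarrow> i \<noteq> j \<Longrightarrow> x i j * x j i = (norm (A $$ (i, j)))\<^sup>2"
    "\<And>i. i < n \<Longrightarrow> A $$ (i, i) = of_real (d i)"
    "\<And>i. i < n \<Longrightarrow> sum (x i) ({..<n} - {i}) \<le> d i"
proof -
  obtain y :: "nat \<Rightarrow> nat \<Rightarrow> real" and d where
    y_nonneg: "\<And>i j. 0 \<le> y i j" and
    y: "\<And>i j. i < n \<Longrightarrow> j < n \<Longrightarrow> i \<noteq> j \<Longrightarrow> (norm (A $$ (i, j)))\<^sup>2 \<le> y i j * y j i" and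
    d: "\<And>i. i < n \<Longrightarrow> A $$ (i, i) = of_real (d i)" and
    y_sum: "\<And>i. i < n \<Longrightarrow> sum (y i) ({..<n} - {i}) \<le> d i"
    using excess_weights_below_diagonal[OF A vs] by metis
  define x where "x i j = (if i < j then y i j else (norm (A $$ (i, j)))\<^sup>2 / y j i)" for i j
  have y_pos: "0 < y i j" if "i < n" "j < n" "i \<noteq> j" for i j
  proof -
    have "0 < (norm (A $$ (i, j)))\<^sup>2"
      using nz that by simp
    then have "y i j \<noteq> 0"
      using y[OF that] by auto
    then show ?thesis
      using y_nonneg[of i j] by simp
  qed
  have sym: "norm (A $$ (j, i)) = norm (A $$ (i, j))" if "i < n" "j < n" for i j
    using hermitian_of_decomp[OF A vs that] by (simp add: norm_conjugate)
  show thesis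
  proof (rule that[of x d])
    fix i j assume ij: "i < n" "j < n" "i \<noteq> j"
    show "0 < x i j"
      using y_pos ij nz by (auto simp: x_def)
    show "x i j * x j i = (norm (A $$ (i, j)))\<^sup>2"
      using ij y_pos[of i j] y_pos[of j i] sym[of i j] by (auto simp: x_def)
  next
    fix i assume i: "i < n"
    have "x i j \<le> y i j" if "j \<in> {..<n} - {i}" for j
      using y[of i j] y_pos[of j i] i that by (auto simp: x_def pos_divide_le_eq)
    then have "sum (x i) ({..<n} - {i}) \<le> sum (y i) ({..<n} - {i})"
      by (rule sum_mono)
    then show "sum (x i) ({..<n} - {i}) \<le> d i"
      using y_sum[OF i] by linarith
  qed (rule d)
qed

text \<open>
  The vector with entries \<open>\<surd>x\<close> and \<open>cnj c / \<surd>x\<close> realizes the positive semidefinite \<open>2 \<times> 2\<close> block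
  with diagonal \<open>x\<close>, \<open>x'\<close> and off-diagonal entry \<open>c\<close> precisely because this block is singular.
\<close>

lemma rank_one_block:
  fixes c :: "'a :: normed_conjugatable_field"
  assumes ij: "i < n" "j < n" "i \<noteq> j" and pos: "0 < x" and prod: "x * x' = (norm c)\<^sup>2"
  obtains v where "v \<in> carrier_vec n" "support v \<subseteq> {i, j}"
    "v $ i * conjugate (v $ j) = c" "v $ j * conjugate (v $ i) = conjugate c"
    "v $ i * conjugate (v $ i) = of_real x" "v $ j * conjugate (v $ j) = of_real x'"
proof -
  define s :: 'a where "s = of_real (sqrt x)"
  have s: "s \<noteq> 0" "(norm s)\<^sup>2 = x"
    using pos by (auto simp: s_def)
  define v where "v = vec n (\<lambda>k. if k = i then s else if k = j then conjugate (c / s) else 0)"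
  have v: "v $ i = s" "v $ j = conjugate (c / s)"
    using ij by (auto simp: v_def)
  have off: "v $ i * conjugate (v $ j) = c"
    using s by (simp add: v)
  show thesis
  proof (rule that[of v])
    show "v \<in> carrier_vec n" "support v \<subseteq> {i, j}"
      by (auto simp: v_def support_def split: if_splits)
    show "v $ i * conjugate (v $ j) = c"
      by (fact off)
    show "v $ j * conjugate (v $ i) = conjugate c"
      by (simp add: conjugate_dist_mul mult.commute flip: off)
    show "v $ i * conjugate (v $ i) = of_real x"
      by (simp only: mult_conjugate_self v s)
    have "(norm (v $ j))\<^sup>2 = x'"
      using prod pos s by (simp add: v norm_conjugate norm_divide power_divide field_simps)
    then show "v $ j * conjugate (v $ j) = of_real x'"
      by (simp only: mult_conjugate_self)
  qed
qed

lemma fw_decomp_of_weights: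
  fixes A :: "'a :: normed_conjugatable_field mat"
  assumes A: "A \<in> carrier_mat n n"
    and herm: "\<And>i j. i < n \<Longrightarrow> j < n \<Longrightarrow> A $$ (j, i) = conjugate (A $$ (i, j))"
    and pos: "\<And>i j. i < n \<Longrightarrow> j < n \<Longrightarrow> i \<noteq> j \<Longrightarrow> 0 < x i j"
    and prod: "\<And>i j. i < n \<Longrightarrow> j < n \<Longrightarrow> i \<noteq> j \<Longrightarrow> x i j * x j i = (norm (A $$ (i, j)))\<^sup>2"
    and diag: "\<And>i. i < n \<Longrightarrow> A $$ (i, i) = of_real (sum (x i) ({..<n} - {i}))"
  obtains vs where "fw_decomp 2 A vs" "length vs = n choose 2"
proof -
  define E where "E = {B. B \<subseteq> {..<n} \<and> card B = 2}"
  have finE: "finite E"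
    unfolding E_def by (rule finite_subset[of _ "Pow {..<n}"]) auto
  have "\<exists>v. v \<in> carrier_vec n \<and> support v \<subseteq> B \<and>
      (\<forall>i j. B = {i, j} \<longrightarrow> i \<noteq> j \<longrightarrow> v $ i * conjugate (v $ j) = A $$ (i, j) \<and>
        v $ i * conjugate (v $ i) = of_real (x i j))" if B_E: "B \<in> E" for B
  proof -
    obtain i j where B: "B = {i, j}" and ij: "i \<noteq> j" "i < n" "j < n"
      using B_E unfolding E_def card_2_iff by auto
    obtain v where v: "v \<in> carrier_vec n" "support v \<subseteq> {i, j}"
      "v $ i * conjugate (v $ j) = A $$ (i, j)" "v $ j * conjugate (v $ i) = A $$ (j, i)"
      "v $ i * conjugate (v $ i) = of_real (x i j)" "v $ j * conjugate (v $ j) = of_real (x j i)"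
      using rank_one_block[OF ij(2,3,1) pos prod] ij herm[OF ij(2,3)] by metis
    show ?thesis
      using v by (intro exI[of _ v]) (auto simp: B doubleton_eq_iff)
  qed
  then obtain w where w: "\<And>B. B \<in> E \<Longrightarrow> w B \<in> carrier_vec n" "\<And>B. B \<in> E \<Longrightarrow> support (w B) \<subseteq> B"
    "\<And>i j. {i, j} \<in> E \<Longrightarrow> i \<noteq> j \<Longrightarrow> w {i, j} $ i * conjugate (w {i, j} $ j) = A $$ (i, j)"
    "\<And>i j. {i, j} \<in> E \<Longrightarrow> i \<noteq> j \<Longrightarrow> w {i, j} $ i * conjugate (w {i, j} $ i) = of_real (x i j)"
    by metis
  obtain Bs where Bs: "set Bs = E" "distinct Bs"
    using finite_distinct_list[OF finE] by blast
  have w_zero: "w B $ i = 0" if "B \<in> E" "i < n" "i \<notin> B" for B i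
    using w(1,2)[OF that(1)] that by (auto simp: support_def)
  have "A $$ (i, j) = (\<Sum>v\<leftarrow>map w Bs. v $ i * conjugate (v $ j))" if ij: "i < n" "j < n" for i j
  proof -
    have list: "(\<Sum>v\<leftarrow>map w Bs. v $ i * conjugate (v $ j)) = (\<Sum>B\<in>E. w B $ i * conjugate (w B $ j))"
      using Bs by (simp add: sum_list_distinct_conv_sum_set comp_def)
    show ?thesis
    proof (cases "i = j")
      case True
      have "(\<Sum>B\<in>E. w B $ i * conjugate (w B $ i)) =
        (\<Sum>B\<in>(\<lambda>k. {i, k}) ` ({..<n} - {i}). w B $ i * conjugate (w B $ i))"
      proof (rule sum.mono_neutral_right[OF finE])
        show "(\<lambda>k. {i, k}) ` ({..<n} - {i}) \<subseteq> E"
          using ij by (auto simp: E_def)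
        have "B \<in> (\<lambda>k. {i, k}) ` ({..<n} - {i})" if "B \<in> E" "i \<in> B" for B
          using that by (auto simp: E_def card_2_iff)
        then show "\<forall>B\<in>E - (\<lambda>k. {i, k}) ` ({..<n} - {i}). w B $ i * conjugate (w B $ i) = 0"
          using w_zero ij by (metis DiffE mult_zero_left)
      qed
      also have "\<dots> = (\<Sum>k\<in>{..<n} - {i}. w {i, k} $ i * conjugate (w {i, k} $ i))"
        by (rule sum.reindex_cong[of "\<lambda>k. {i, k}"]) (auto simp: inj_on_def doubleton_eq_iff)
      also have "\<dots> = (\<Sum>k\<in>{..<n} - {i}. of_real (x i k))"
        using ij by (intro sum.cong w(4)) (auto simp: E_def)
      finally show ?thesis
        unfolding list using True diag ij by simp
    next
      case False
      then have ij_E: "{i, j} \<in> E"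
        using ij by (auto simp: E_def)
      have "B = {i, j}" if "B \<in> E" "i \<in> B" "j \<in> B" for B
        using that False by (auto simp: E_def card_2_iff)
      then have "\<forall>B\<in>E - {{i, j}}. w B $ i * conjugate (w B $ j) = 0"
        using w_zero ij by (metis DiffE singletonI conjugate_zero mult_zero_left mult_zero_right)
      then have "(\<Sum>B\<in>E. w B $ i * conjugate (w B $ j)) =
        (\<Sum>B\<in>{{i, j}}. w B $ i * conjugate (w B $ j))"
        using ij_E by (intro sum.mono_neutral_right[OF finE]) auto
      then show ?thesis
        unfolding list using w(3)[OF ij_E False] by simp
    qed
  qed
  moreover have "card (support (w B)) \<le> 2" if "B \<in> E" for B
    using card_mono[OF _ w(2)[OF that]] that by (auto simp: E_def intro: finite_subset)
  ultimately have "fw_decomp 2 A (map w Bs)"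
    using w(1) Bs by (simp add: fw_decomp_iff[OF A])
  moreover have "length (map w Bs) = n choose 2"
    using distinct_card[OF Bs(2)] by (simp add: Bs(1) E_def n_subsets)
  ultimately show thesis
    by (rule that)
qed

section \<open>The factor-width-2 rank\<close>

lemma fran_two_eq_choose_two:
  fixes A :: "'a :: normed_conjugatable_field mat"
  assumes n: "3 \<le> n" and A: "A \<in> carrier_mat n n" and width: "factor_width A = 2"
    and nz: "\<forall>i < n. \<forall>j < n. A $$ (i, j) \<noteq> 0"
  shows "fran 2 A = enat (n choose 2)"
proof -
  obtain vs where vs: "fw_decomp 2 A vs"
    using width factor_width_eq_iff[of A 2] by (auto simp: numeral_eq_enat)
  obtain x :: "nat \<Rightarrow> nat \<Rightarrow> real" and d where x:
    "\<And>i j. i < n \<Longrightarrow> j < n \<Longrightarrow> i \<noteq> j \<Longrightarrow> 0 < x i j"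
    "\<And>i j. i < n \<Longrightarrow> j < n \<Longrightarrow> i \<noteq> j \<Longrightarrow> x i j * x j i = (norm (A $$ (i, j)))\<^sup>2"
    "\<And>i. i < n \<Longrightarrow> A $$ (i, i) = of_real (d i)"
    "\<And>i. i < n \<Longrightarrow> sum (x i) ({..<n} - {i}) \<le> d i"
    by (rule weights_below_diagonal[OF A vs nz]) (rule that)
  obtain y where y:
    "\<And>i j. i \<in> {..<n} \<Longrightarrow> j \<in> {..<n} \<Longrightarrow> i \<noteq> j \<Longrightarrow> 0 < y i j"
    "\<And>i j. i \<in> {..<n} \<Longrightarrow> j \<in> {..<n} \<Longrightarrow> i \<noteq> j \<Longrightarrow> y i j * y j i = x i j * x j i"
    "\<And>i. i \<in> {..<n} \<Longrightarrow> sum (y i) ({..<n} - {i}) = d i"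
    by (rule fill_all_rows[of "{..<n}" x d]) (use n x in auto)
  obtain ws where "fw_decomp 2 A ws" "length ws = n choose 2"
    by (rule fw_decomp_of_weights[OF A hermitian_of_decomp[OF A vs], of y]) (use x y in auto)
  then show ?thesis
    using choose_two_le_length_decomp[OF A _ nz] by (auto simp: fran_eq_iff)
qed

theorem corollary2:
  fixes n :: nat
  assumes "n \<ge> 3"
  shows "(\<forall>A \<in> (psd_mats n :: real mat set).
            factor_width A = 2 \<and> (\<forall>i < n. \<forall>j < n. A $$ (i, j) \<noteq> 0) \<longrightarrow>
            fran 2 A = enat (n * (n - 1) div 2)) \<and>
         (\<forall>A \<in> (psd_mats n :: complex mat set).
            factor_width A = 2 \<and> (\<forall>i < n. \<forall>j < n. A $$ (i, j) \<noteq> 0) \<longrightarrow>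
            fran 2 A = enat (n * (n - 1) div 2))"
  using assms by (simp only: psd_mats_def mem_Collect_eq Ball_def choose_two[symmetric])
    (blast intro: fran_two_eq_choose_two)

end
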